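(* Let $\mathcal{M}^3=\mathbb{R}^3$ with standard coordinates $(x_1,x_2,x_3)$, equipped with the Riemannian metric $$g=dx_1\otimes dx_1+dx_2\otimes dx_2+(x_1\,dx_2+dx_3)\otimes(x_1\,dx_2+dx_3),$$ let $$X=-x_1\frac{\partial}{\partial x_1}-x_2\frac{\partial}{\partial x_2}-2x_3\frac{\partial}{\partial x_3},$$ and let $\alpha=3$ (the $\mathrm{nil}^3$ soliton $(\mathcal{M}^3,g,X,3)$). Let $$Lh=\Delta_\ell h-\mathcal{L}_X h-3h$$ be the linearization at $(\mathcal{M}^3,g,X,3)$ of the modified Ricci flow $\frac{\partial}{\partial\tau}g=-2\operatorname{Rc}(g)-\mathcal{L}_Xg-3g$. Then this linearization is strictly linearly stable, in the sense that for every smooth compactly supported real symmetric $(2,0)$-tensor field $h$ on $\mathcal{M}^3$, $$\int_{\mathcal{M}^3}\langle Lh,h\rangle\,d\mu\le-\|\nabla h\|^2-\omega\|h\|^2\qquad\text{with }\omega=\tfrac12.$$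
   Context: A $(2,0)$-tensor field is a covariant 2-tensor field $h=h_{ij}$. A Ricci soliton structure $(\mathcal{M}^n,g,X,\alpha)$ satisfies $2\operatorname{Rc}(g)+\alpha g+\mathcal{L}_Xg=0$; it is called expanding if $\alpha>0$. $\nabla$ is the Levi-Civita connection of $g$, $d\mu$ its volume measure, $\langle\cdot,\cdot\rangle$ the pointwise inner product on tensors induced by $g$ (so $|h|^2=g^{ik}g^{jl}h_{ij}h_{kl}$), and $\|\cdot\|$ the $L^2$ norm with respect to $d\mu$. $\mathcal{L}_X$ is the Lie derivative. $\Delta_\ell$ is the Lichnerowicz Laplacian $$\Delta_\ell h_{ij}=\Delta h_{ij}+2R_{ipqj}h^{pq}-R_i^kh_{kj}-R_j^kh_{ik},$$ where $\Delta=g^{ij}\nabla_i\nabla_j$ is the rough Laplacian, $R_{ij}$ is the Ricci tensor, and the sign convention for $R_{ijkl}$ is that $R_{ijji}$ is the sectional curvature of the plane spanned by orthonormal vectors $e_i,e_j$. The linearization is taken after the DeTurck modification (the vector field is varied together with the metric so as to make the linearized operator elliptic), which gives exactly the operator $L$ displayed in the claim. *)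

theory Defs
  imports "HOL-Analysis.Analysis"
begin

text \<open>
  Riemannian geometry on \<open>\<real>\<^sup>n\<close> in the global standard chart.  A tensor field is represented by its
  array of components with respect to the coordinate frame; \<open>\<partial>/\<partial>x\<^sub>i\<close> and \<open>dx\<^sub>i\<close> both have component
  vector \<^term>\<open>axis i 1\<close>.
\<close>

type_synonym 'n scalar_field = "real^'n \<Rightarrow> real"
type_synonym 'n vector_field = "real^'n \<Rightarrow> real^'n"
type_synonym 'n tensor2_field = "real^'n \<Rightarrow> real^'n^'n"
type_synonym 'n tensor3_field = "real^'n \<Rightarrow> real^'n^'n^'n"
type_synonym 'n tensor4_field = "real^'n \<Rightarrow> real^'n^'n^'n^'n"

primrec times_differentiable :: "nat \<Rightarrow> ('a::real_normed_vector \<Rightarrow> 'b::real_normed_vector) \<Rightarrow> bool" where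
  "times_differentiable 0 f \<longleftrightarrow> continuous_on UNIV f"
| "times_differentiable (Suc k) f \<longleftrightarrow>
     (\<forall>x. f differentiable at x) \<and>
     (\<forall>v. times_differentiable k (\<lambda>x. frechet_derivative f (at x) v))"

definition smooth :: "('a::real_normed_vector \<Rightarrow> 'b::real_normed_vector) \<Rightarrow> bool" where
  "smooth f \<longleftrightarrow> (\<forall>k. times_differentiable k f)"

definition compactly_supported :: "('a::real_normed_vector \<Rightarrow> 'b::real_normed_vector) \<Rightarrow> bool" where
  "compactly_supported f \<longleftrightarrow> compact (closure (support_on UNIV f))"

definition symmetric_tensor :: "('n::finite) tensor2_field \<Rightarrow> bool" where
  "symmetric_tensor h \<longleftrightarrow> (\<forall>x i j. h x $ i $ j = h x $ j $ i)"

definition tensor_prod :: "real^'n \<Rightarrow> real^'n \<Rightarrow> real^'n^'n" (infixl "\<otimes>" 75) where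
  "a \<otimes> b = (\<chi> i j. a $ i * b $ j)"

definition pd :: "'n::finite \<Rightarrow> 'n scalar_field \<Rightarrow> 'n scalar_field" where
  "pd i f x = frechet_derivative f (at x) (axis i 1)"

definition metric_inv :: "('n::finite) tensor2_field \<Rightarrow> 'n tensor2_field" where
  "metric_inv g x = matrix_inv (g x)"

text \<open>\<open>christoffel g x $ l $ i $ j\<close> is \<open>\<Gamma>\<^sup>l\<^sub>i\<^sub>j\<close>.\<close>

definition christoffel :: "('n::finite) tensor2_field \<Rightarrow> 'n tensor3_field" where
  "christoffel g x = (\<chi> l i j. (1/2) * (\<Sum>m\<in>UNIV. metric_inv g x $ l $ m *
     (pd i (\<lambda>y. g y $ j $ m) x + pd j (\<lambda>y. g y $ i $ m) x - pd m (\<lambda>y. g y $ i $ j) x)))"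

text \<open>
  Covariant derivatives of covariant 2- and 3-tensors; the index of differentiation comes first:
  \<open>nabla2 g h x $ k $ i $ j\<close> is \<open>\<nabla>\<^sub>k h\<^sub>i\<^sub>j\<close>.
\<close>

definition nabla2 :: "('n::finite) tensor2_field \<Rightarrow> 'n tensor2_field \<Rightarrow> 'n tensor3_field" where
  "nabla2 g h x = (\<chi> k i j. pd k (\<lambda>y. h y $ i $ j) x
     - (\<Sum>m\<in>UNIV. christoffel g x $ m $ k $ i * h x $ m $ j)
     - (\<Sum>m\<in>UNIV. christoffel g x $ m $ k $ j * h x $ i $ m))"

definition nabla3 :: "('n::finite) tensor2_field \<Rightarrow> 'n tensor3_field \<Rightarrow> 'n tensor4_field" where
  "nabla3 g t x = (\<chi> l k i j. pd l (\<lambda>y. t y $ k $ i $ j) x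
     - (\<Sum>m\<in>UNIV. christoffel g x $ m $ l $ k * t x $ m $ i $ j)
     - (\<Sum>m\<in>UNIV. christoffel g x $ m $ l $ i * t x $ k $ m $ j)
     - (\<Sum>m\<in>UNIV. christoffel g x $ m $ l $ j * t x $ k $ i $ m))"

definition rough_laplacian :: "('n::finite) tensor2_field \<Rightarrow> 'n tensor2_field \<Rightarrow> 'n tensor2_field" where
  "rough_laplacian g h x = (\<chi> i j. \<Sum>l\<in>UNIV. \<Sum>k\<in>UNIV.
     metric_inv g x $ l $ k * nabla3 g (nabla2 g h) x $ l $ k $ i $ j)"

text \<open>
  \<open>curvature_op g x $ i $ j $ k $ l\<close> is the coefficient of \<open>\<partial>\<^sub>l\<close> in
  \<open>\<nabla>\<^sub>i \<nabla>\<^sub>j \<partial>\<^sub>k - \<nabla>\<^sub>j \<nabla>\<^sub>i \<partial>\<^sub>k\<close>; lowering \<open>l\<close> in the fourth slot makes \<open>R\<^sub>i\<^sub>j\<^sub>j\<^sub>i\<close> a sectional curvature for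
  orthonormal vectors.
\<close>

definition curvature_op :: "('n::finite) tensor2_field \<Rightarrow> 'n tensor4_field" where
  "curvature_op g x = (\<chi> i j k l.
     pd i (\<lambda>y. christoffel g y $ l $ j $ k) x - pd j (\<lambda>y. christoffel g y $ l $ i $ k) x
     + (\<Sum>m\<in>UNIV. christoffel g x $ l $ i $ m * christoffel g x $ m $ j $ k)
     - (\<Sum>m\<in>UNIV. christoffel g x $ l $ j $ m * christoffel g x $ m $ i $ k))"

definition riemann :: "('n::finite) tensor2_field \<Rightarrow> 'n tensor4_field" where
  "riemann g x = (\<chi> i j k l. \<Sum>m\<in>UNIV. g x $ l $ m * curvature_op g x $ i $ j $ k $ m)"

definition ricci :: "('n::finite) tensor2_field \<Rightarrow> 'n tensor2_field" where
  "ricci g x = (\<chi> j k. \<Sum>i\<in>UNIV. \<Sum>l\<in>UNIV. metric_inv g x $ i $ l * riemann g x $ i $ j $ k $ l)"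

definition raise2 :: "('n::finite) tensor2_field \<Rightarrow> 'n tensor2_field \<Rightarrow> 'n tensor2_field" where
  "raise2 g h x = (\<chi> p q. \<Sum>a\<in>UNIV. \<Sum>b\<in>UNIV.
     metric_inv g x $ p $ a * metric_inv g x $ q $ b * h x $ a $ b)"

text \<open>\<open>ricci_mixed g x $ i $ k\<close> is \<open>R\<^sub>i\<^sup>k\<close>.\<close>

definition ricci_mixed :: "('n::finite) tensor2_field \<Rightarrow> 'n tensor2_field" where
  "ricci_mixed g x = (\<chi> i k. \<Sum>l\<in>UNIV. metric_inv g x $ k $ l * ricci g x $ i $ l)"

definition lichnerowicz_laplacian ::
    "('n::finite) tensor2_field \<Rightarrow> 'n tensor2_field \<Rightarrow> 'n tensor2_field" where
  "lichnerowicz_laplacian g h x = (\<chi> i j.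
     rough_laplacian g h x $ i $ j
     + 2 * (\<Sum>p\<in>UNIV. \<Sum>q\<in>UNIV. riemann g x $ i $ p $ q $ j * raise2 g h x $ p $ q)
     - (\<Sum>k\<in>UNIV. ricci_mixed g x $ i $ k * h x $ k $ j)
     - (\<Sum>k\<in>UNIV. ricci_mixed g x $ j $ k * h x $ i $ k))"

definition lie_derivative :: "('n::finite) vector_field \<Rightarrow> 'n tensor2_field \<Rightarrow> 'n tensor2_field" where
  "lie_derivative X h x = (\<chi> i j. \<Sum>k\<in>UNIV.
     X x $ k * pd k (\<lambda>y. h y $ i $ j) x
     + h x $ k $ j * pd i (\<lambda>y. X y $ k) x
     + h x $ i $ k * pd j (\<lambda>y. X y $ k) x)"

definition ricci_soliton :: "('n::finite) tensor2_field \<Rightarrow> 'n vector_field \<Rightarrow> real \<Rightarrow> bool" where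
  "ricci_soliton g X \<alpha> \<longleftrightarrow>
     (\<forall>x. 2 *\<^sub>R ricci g x + \<alpha> *\<^sub>R g x + lie_derivative X g x = 0)"

text \<open>
  Linearization at a soliton \<open>(g, X, \<alpha>)\<close> of \<open>\<partial>g/\<partial>\<tau> = -2 Rc(g) - \<L>\<^sub>X g - \<alpha> g\<close> after the DeTurck
  modification.
\<close>

definition linearized_flow ::
    "('n::finite) tensor2_field \<Rightarrow> 'n vector_field \<Rightarrow> real \<Rightarrow> 'n tensor2_field \<Rightarrow> 'n tensor2_field" where
  "linearized_flow g X \<alpha> h x =
     lichnerowicz_laplacian g h x - lie_derivative X h x - \<alpha> *\<^sub>R h x"

definition inner2 ::
    "('n::finite) tensor2_field \<Rightarrow> 'n tensor2_field \<Rightarrow> 'n tensor2_field \<Rightarrow> 'n scalar_field" where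
  "inner2 g h k x = (\<Sum>i\<in>UNIV. \<Sum>j\<in>UNIV. \<Sum>a\<in>UNIV. \<Sum>b\<in>UNIV.
     metric_inv g x $ i $ a * metric_inv g x $ j $ b * h x $ i $ j * k x $ a $ b)"

definition inner3 ::
    "('n::finite) tensor2_field \<Rightarrow> 'n tensor3_field \<Rightarrow> 'n tensor3_field \<Rightarrow> 'n scalar_field" where
  "inner3 g s t x = (\<Sum>i\<in>UNIV. \<Sum>j\<in>UNIV. \<Sum>k\<in>UNIV. \<Sum>a\<in>UNIV. \<Sum>b\<in>UNIV. \<Sum>c\<in>UNIV.
     metric_inv g x $ i $ a * metric_inv g x $ j $ b * metric_inv g x $ k $ c
     * s x $ i $ j $ k * t x $ a $ b $ c)"

definition volume_measure :: "('n::finite) tensor2_field \<Rightarrow> (real^'n) measure" where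
  "volume_measure g = density lborel (\<lambda>x. ennreal (sqrt (det (g x))))"

text \<open>
  In all integrals below \<open>h\<close> is smooth with compact support, so the integrands are continuous with
  compact support and the default value \<open>0\<close> of the Bochner integral plays no role.
\<close>

definition L2_norm2 :: "('n::finite) tensor2_field \<Rightarrow> 'n tensor2_field \<Rightarrow> real" where
  "L2_norm2 g h = sqrt (LINT x|volume_measure g. inner2 g h h x)"

definition L2_norm3 :: "('n::finite) tensor2_field \<Rightarrow> 'n tensor3_field \<Rightarrow> real" where
  "L2_norm3 g t = sqrt (LINT x|volume_measure g. inner3 g t t x)"


definition nil3_metric :: "3 tensor2_field" where
  "nil3_metric x =
     (let dx = \<lambda>i. axis i 1; \<theta> = x $ 1 *\<^sub>R dx 2 + dx 3
      in dx 1 \<otimes> dx 1 + dx 2 \<otimes> dx 2 + \<theta> \<otimes> \<theta>)"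

definition nil3_field :: "3 vector_field" where
  "nil3_field x =
     (- x $ 1) *\<^sub>R axis 1 1 - x $ 2 *\<^sub>R axis 2 1 - (2 * x $ 3) *\<^sub>R axis 3 1"

text \<open>
  \<open>(nil3_metric, nil3_field, 3)\<close> is an expanding Ricci soliton for the conventions above.
\<close>

lemma nil3_metric_nth:
  "nil3_metric x $ 1 $ 1 = 1" "nil3_metric x $ 1 $ 2 = 0" "nil3_metric x $ 1 $ 3 = 0"
  "nil3_metric x $ 2 $ 1 = 0" "nil3_metric x $ 2 $ 2 = 1 + (x $ 1)\<^sup>2" "nil3_metric x $ 2 $ 3 = x $ 1"
  "nil3_metric x $ 3 $ 1 = 0" "nil3_metric x $ 3 $ 2 = x $ 1" "nil3_metric x $ 3 $ 3 = 1"
  by (simp_all add: nil3_metric_def tensor_prod_def Let_def axis_def power2_eq_square)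

definition nil3_inv :: "3 tensor2_field" where
  "nil3_inv x = (let e = \<lambda>i. axis i 1; u = e 2 - x $ 1 *\<^sub>R e 3
      in e 1 \<otimes> e 1 + u \<otimes> u + e 3 \<otimes> e 3)"

lemma nil3_inv_nth:
  "nil3_inv x $ 1 $ 1 = 1" "nil3_inv x $ 1 $ 2 = 0" "nil3_inv x $ 1 $ 3 = 0"
  "nil3_inv x $ 2 $ 1 = 0" "nil3_inv x $ 2 $ 2 = 1" "nil3_inv x $ 2 $ 3 = - x $ 1"
  "nil3_inv x $ 3 $ 1 = 0" "nil3_inv x $ 3 $ 2 = - x $ 1" "nil3_inv x $ 3 $ 3 = 1 + (x $ 1)\<^sup>2"
  by (simp_all add: nil3_inv_def tensor_prod_def Let_def axis_def power2_eq_square)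

lemma metric_inv_nil3: "metric_inv nil3_metric x = nil3_inv x"
proof -
  have 1: "nil3_metric x ** nil3_inv x = mat 1" "nil3_inv x ** nil3_metric x = mat 1"
    by (simp_all add: vec_eq_iff forall_3 matrix_matrix_mult_def sum_3 nil3_metric_nth nil3_inv_nth mat_def algebra_simps power2_eq_square)
  then have 2: "nil3_metric x ** matrix_inv (nil3_metric x) = mat 1"
    unfolding matrix_inv_def by (rule_tac someI2[of _ "nil3_inv x"]) auto
  have "metric_inv nil3_metric x = (nil3_inv x ** nil3_metric x) ** metric_inv nil3_metric x"
    by (simp add: 1)
  also have "\<dots> = nil3_inv x ** (nil3_metric x ** metric_inv nil3_metric x)"
    by (rule matrix_mul_assoc[symmetric])
  also have "\<dots> = nil3_inv x"
    using 2 by (simp add: metric_inv_def)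
  finally show ?thesis .
qed

lemma pd_eq: "(f has_derivative D) (at x) \<Longrightarrow> pd i f x = D (axis i 1)"
  unfolding pd_def by (metis frechet_derivative_at)

lemma pd_poly: "pd i (\<lambda>y. a + b * y $ k + c * (y $ k)\<^sup>2) x = (b + 2 * c * x $ k) * axis i 1 $ k"
  by (rule pd_eq[THEN trans], (rule derivative_eq_intros bounded_linear_imp_has_derivative bounded_linear_vec_nth refl)+)
    (simp add: algebra_simps)

lemma pd_basic:
  "pd i (\<lambda>y. a) x = 0"
  "pd i (\<lambda>y. y $ k) x = axis i 1 $ k"
  "pd i (\<lambda>y. b * y $ k) x = b * axis i 1 $ k"
  "pd i (\<lambda>y. y $ k / 2) x = axis i 1 $ k / 2"
  "pd i (\<lambda>y. - y $ k) x = - axis i 1 $ k"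
  "pd i (\<lambda>y. - (y $ k / 2)) x = - (axis i 1 $ k / 2)"
  "pd i (\<lambda>y. - (b * y $ k)) x = - (b * axis i 1 $ k)"
  "pd i (\<lambda>y. a + (y $ k)\<^sup>2) x = 2 * x $ k * axis i 1 $ k"
  "pd i (\<lambda>y. a - (y $ k)\<^sup>2/2) x = - (x $ k * axis i 1 $ k)"
  using pd_poly[of i a 0 k 0 x] pd_poly[of i 0 1 k 0 x] pd_poly[of i 0 b k 0 x]
    pd_poly[of i 0 "1/2" k 0 x] pd_poly[of i 0 "-1" k 0 x] pd_poly[of i 0 "-1/2" k 0 x]
    pd_poly[of i 0 "-b" k 0 x] pd_poly[of i a 0 k 1 x] pd_poly[of i a 0 k "-1/2" x]
  by (simp_all only: mult_zero_left mult_1_left add_0_left add_0_right mult_minus_left minus_divide_left[symmetric] times_divide_eq_left) (simp_all)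

definition nil3_chr :: "3 tensor3_field" where
  "nil3_chr x = (\<chi> l i j. if {i,j} = {2} then (if l = 1 then - x $ 1 else 0)
     else if {i,j} = {2,3} then (if l = 1 then - 1/2 else 0)
     else if {i,j} = {1,2} then (if l = 2 then x $ 1 / 2 else if l = 3 then 1/2 - (x $ 1)\<^sup>2 / 2 else 0)
     else if {i,j} = {1,3} then (if l = 2 then 1/2 else if l = 3 then - (x $ 1 / 2) else 0)
     else 0)"

lemma pd_sq: "pd i (\<lambda>y. 1 + y $ k * y $ k) x = 2 * x $ k * axis i 1 $ k"
  using pd_basic(8)[of i 1 k x] by (simp add: power2_eq_square)

lemma christoffel_nil3: "christoffel nil3_metric x = nil3_chr x"
  by (simp add: vec_eq_iff forall_3 christoffel_def nil3_chr_def sum_3 metric_inv_nil3 nil3_inv_nth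
      nil3_metric_nth pd_basic pd_sq axis_def doubleton_eq_iff field_simps power2_eq_square)

lemma pd_chr: "pd i (\<lambda>y. nil3_chr y $ l $ j $ k) x = (if i \<noteq> 1 then 0
     else if {j,k} = {2} then (if l = 1 then - 1 else 0)
     else if {j,k} = {1,2} then (if l = 2 then 1 / 2 else if l = 3 then - x $ 1 else 0)
     else if {j,k} = {1,3} then (if l = 3 then - 1 / 2 else 0)
     else 0)"
proof -
  have "\<forall>i l j k. pd i (\<lambda>y. nil3_chr y $ l $ j $ k) x = (if i \<noteq> 1 then 0
     else if {j,k} = {2} then (if l = 1 then - 1 else 0)
     else if {j,k} = {1,2} then (if l = 2 then 1 / 2 else if l = 3 then - x $ 1 else 0)
     else if {j,k} = {1,3} then (if l = 3 then - 1 / 2 else 0)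
     else 0)"
    apply (simp add: forall_3 nil3_chr_def doubleton_eq_iff)
    apply (simp only: pd_basic)
    apply (simp add: axis_def)
    done
  then show ?thesis by blast
qed

lemma nil3_chr_nth: "nil3_chr x $ l $ i $ j = (if {i,j} = {2} then (if l = 1 then - x $ 1 else 0)
     else if {i,j} = {2,3} then (if l = 1 then - 1/2 else 0)
     else if {i,j} = {1,2} then (if l = 2 then x $ 1 / 2 else if l = 3 then 1/2 - (x $ 1)\<^sup>2 / 2 else 0)
     else if {i,j} = {1,3} then (if l = 2 then 1/2 else if l = 3 then - (x $ 1 / 2) else 0)
     else 0)"
  by (simp add: nil3_chr_def)

lemma ricci_nil3: "\<forall>j k. ricci nil3_metric x $ j $ k = (if j = 1 \<and> k = 1 then -1/2
    else if j = 2 \<and> k = 2 then (x$1)^2/2 - 1/2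
    else if {j,k}={2,3} then x$1/2 else if j = 3 \<and> k = 3 then 1/2 else 0)"
  apply (simp only: ricci_def riemann_def curvature_op_def christoffel_nil3 pd_chr vec_lambda_beta metric_inv_nil3)
  apply (simp only: forall_3 sum_3 nil3_inv_nth nil3_metric_nth mult_zero_left mult_1_left add_0_left add_0_right)
  apply (simp add: nil3_chr_nth doubleton_eq_iff)
  apply (simp add: field_simps power2_eq_square)
  done

lemma nil3_field_nth: "nil3_field x $ 1 = - x $ 1" "nil3_field x $ 2 = - x $ 2" "nil3_field x $ 3 = - (2 * x $ 3)"
  by (simp_all add: nil3_field_def axis_def)

lemma nil3_soliton: "ricci_soliton nil3_metric nil3_field 3"
  apply (simp only: ricci_soliton_def vec_eq_iff lie_derivative_def vector_add_component
      vector_scaleR_component ricci_nil3 vec_lambda_beta)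
  apply (simp only: forall_3 sum_3 nil3_metric_nth nil3_field_nth pd_basic)
  apply (simp add: doubleton_eq_iff axis_def)
  apply (simp add: field_simps power2_eq_square)
  done

end

theory Submission
  imports Defs
begin

text \<open>
  Since \<open>\<integral> \<langle>\<Delta>h, h\<rangle> = - \<parallel>\<nabla>h\<parallel>\<^sup>2\<close> and \<open>\<integral> \<langle>\<nabla>\<^sub>X h, h\<rangle> = - (1/2) \<integral> (div X) |h|\<^sup>2\<close> with \<open>div X = -4\<close>, and since the
  soliton equation makes the Ricci terms of the Lichnerowicz Laplacian cancel the symmetrized
  \<open>\<nabla>X\<close> and the term \<open>-3h\<close>, one gets
  \<open>\<integral> \<langle>Lh, h\<rangle> = - \<parallel>\<nabla>h\<parallel>\<^sup>2 - 2 \<parallel>h\<parallel>\<^sup>2 + 2 \<integral> Rm(h, h)\<close>.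
  In the orthonormal frame \<open>e\<^sub>1 = \<partial>\<^sub>1\<close>, \<open>e\<^sub>2 = \<partial>\<^sub>2 - x\<^sub>1 \<partial>\<^sub>3\<close>, \<open>e\<^sub>3 = \<partial>\<^sub>3\<close> the sectional curvatures are
  \<open>-3/4\<close>, \<open>1/4\<close>, \<open>1/4\<close>, and completing squares gives \<open>2 Rm(h, h) \<le> (3/2) |h|\<^sup>2\<close>.
\<close>

subsection \<open>Differentiability classes and the divergence theorem\<close>

text \<open>Differentiability implies continuity, which settles the base case; the inductive step
  applies the hypothesis to every directional derivative. The product rule depends on this, because
  it leaves undifferentiated factors behind.\<close>

lemma times_differentiable_SucD:
  "times_differentiable (Suc k) f \<Longrightarrow> times_differentiable k f"
proof (induction k arbitrary: f)
  case 0
  then show ?case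
    by (auto intro!: continuous_at_imp_continuous_on differentiable_imp_continuous_within)
next
  case (Suc k)
  then show ?case by (metis times_differentiable.simps(2))
qed

lemma times_differentiable_const: "times_differentiable k (\<lambda>x. c)"
  by (induction k arbitrary: c) auto

text \<open>The derivative of \<open>L (f x)\<close> in direction \<open>v\<close> is
  \<open>L\<close> of the derivative of \<open>f\<close>, so the induction closes on itself.
  Negation and the extraction of components are instances.\<close>

lemma times_differentiable_bounded_linear:
  assumes L: "bounded_linear L"
  shows "times_differentiable k f \<Longrightarrow> times_differentiable k (\<lambda>x. L (f x))"
proof (induction k arbitrary: f)
  case 0
  then show ?case
    using L by (simp add: linear_continuous_on bounded_linear.continuous_on)
next
  case (Suc k)
  have D: "((\<lambda>x. L (f x)) has_derivative (\<lambda>v. L (frechet_derivative f (at x) v))) (at x)" for x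
    using Suc.prems
    by (intro bounded_linear.has_derivative[OF L]) (simp add: frechet_derivative_works[symmetric])
  then have "frechet_derivative (\<lambda>x. L (f x)) (at x) = (\<lambda>v. L (frechet_derivative f (at x) v))" for x
    by (rule frechet_derivative_at[symmetric])
  moreover have "(\<lambda>x. L (f x)) differentiable at x" for x
    using D unfolding differentiable_def by blast
  ultimately show ?case using Suc by simp
qed

lemma times_differentiable_add:
  "times_differentiable k f \<Longrightarrow> times_differentiable k g \<Longrightarrow> times_differentiable k (\<lambda>x. f x + g x)"
proof (induction k arbitrary: f g)
  case 0
  then show ?case by (simp add: continuous_on_add)
next
  case (Suc k)
  have D: "((\<lambda>x. f x + g x) has_derivative (\<lambda>v. frechet_derivative f (at x) v
      + frechet_derivative g (at x) v)) (at x)" for x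
    using Suc.prems by (intro has_derivative_add) (auto simp: frechet_derivative_works)
  then have "frechet_derivative (\<lambda>x. f x + g x) (at x) = (\<lambda>v. frechet_derivative f (at x) v
      + frechet_derivative g (at x) v)" for x
    by (rule frechet_derivative_at[symmetric])
  moreover have "(\<lambda>x. f x + g x) differentiable at x" for x
    using D unfolding differentiable_def by blast
  ultimately show ?case using Suc by simp
qed

lemma times_differentiable_mult:
  fixes f g :: "'a::real_normed_vector \<Rightarrow> 'b::real_normed_algebra"
  shows "times_differentiable k f \<Longrightarrow> times_differentiable k g \<Longrightarrow>
    times_differentiable k (\<lambda>x. f x * g x)"
proof (induction k arbitrary: f g)
  case 0
  then show ?case by (simp add: continuous_on_mult)
next
  case (Suc k)
  have D: "((\<lambda>x. f x * g x) has_derivative (\<lambda>v. f x * frechet_derivative g (at x) v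
      + frechet_derivative f (at x) v * g x)) (at x)" for x
    using Suc.prems by (intro has_derivative_mult) (auto simp: frechet_derivative_works)
  then have "frechet_derivative (\<lambda>x. f x * g x) (at x) = (\<lambda>v. f x * frechet_derivative g (at x) v
      + frechet_derivative f (at x) v * g x)" for x
    by (rule frechet_derivative_at[symmetric])
  moreover have "(\<lambda>x. f x * g x) differentiable at x" for x
    using D unfolding differentiable_def by blast
  ultimately show ?case
    using Suc.IH Suc.prems times_differentiable_SucD[OF Suc.prems(1)]
      times_differentiable_SucD[OF Suc.prems(2)]
    by (auto intro!: times_differentiable_add)
qed

lemma times_differentiable_minus:
  "times_differentiable k f \<Longrightarrow> times_differentiable k (\<lambda>x. - f x)"
  using times_differentiable_bounded_linear[OF bounded_linear_minus[OF bounded_linear_ident]] .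

lemma times_differentiable_diff:
  "times_differentiable k f \<Longrightarrow> times_differentiable k g \<Longrightarrow> times_differentiable k (\<lambda>x. f x - g x)"
  using times_differentiable_add[of k f "\<lambda>x. - g x"] times_differentiable_minus by auto

lemma times_differentiable_sum:
  "(\<And>i. i \<in> I \<Longrightarrow> times_differentiable k (f i)) \<Longrightarrow> times_differentiable k (\<lambda>x. \<Sum>i\<in>I. f i x)"
  by (induction I rule: infinite_finite_induct)
    (auto intro: times_differentiable_add times_differentiable_const)

lemma times_differentiable_ident: "times_differentiable k (\<lambda>x. x)"
  by (cases k) (auto intro: times_differentiable_const simp: frechet_derivative_ident)

lemma times_differentiable_vec_nth:
  "times_differentiable k f \<Longrightarrow> times_differentiable k (\<lambda>x. f x $ i)"
  by (rule times_differentiable_bounded_linear[OF bounded_linear_vec_nth])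

lemma times_differentiable_pd:
  "times_differentiable (Suc k) f \<Longrightarrow> times_differentiable k (pd i f)"
  unfolding pd_def[abs_def] by simp

lemma times_differentiable_power2:
  fixes f :: "'a::real_normed_vector \<Rightarrow> 'b::real_normed_algebra_1"
  shows "times_differentiable k f \<Longrightarrow> times_differentiable k (\<lambda>x. (f x)\<^sup>2)"
  by (simp add: power2_eq_square times_differentiable_mult)

lemma times_differentiable_divide_const:
  fixes f :: "'a::real_normed_vector \<Rightarrow> 'b::real_normed_field"
  shows "times_differentiable k f \<Longrightarrow> times_differentiable k (\<lambda>x. f x / c)"
  by (simp add: divide_inverse times_differentiable_mult times_differentiable_const)

lemma times_differentiable_coord: "times_differentiable k (\<lambda>x. x $ i)"
  by (rule times_differentiable_vec_nth[OF times_differentiable_ident])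

lemmas times_differentiable_intros =
  times_differentiable_const times_differentiable_add times_differentiable_diff
  times_differentiable_minus times_differentiable_mult times_differentiable_sum
  times_differentiable_coord times_differentiable_power2
  times_differentiable_divide_const

section \<open>Functions vanishing outside a compact set\<close>

lemma has_derivative_zero_outside:
  assumes "closed K" "\<And>y. y \<notin> K \<Longrightarrow> f y = 0" "x \<notin> K"
  shows "(f has_derivative (\<lambda>v. 0)) (at x)"
proof -
  have "((\<lambda>x. 0) has_derivative (\<lambda>v. 0)) (at x)" by simp
  then show ?thesis
    by (rule has_derivative_transform_within_open[of _ _ _ _ "-K"]) (use assms in auto)
qed

lemma pd_zero_outside:
  assumes "closed K" "\<And>y. y \<notin> K \<Longrightarrow> f y = 0" "x \<notin> K"
  shows "pd i f x = 0"
  using pd_eq[OF has_derivative_zero_outside[OF assms]] by simp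

lemma integrable_zero_outside_compact:
  fixes f :: "'a::euclidean_space \<Rightarrow> real"
  assumes "compact K" "continuous_on UNIV f" "\<And>x. x \<notin> K \<Longrightarrow> f x = 0"
  shows "integrable lborel f"
proof -
  have "integrable lborel (\<lambda>x. indicator K x *\<^sub>R f x)"
    using assms(1,2) by (intro borel_integrable_compact) (auto intro: continuous_on_subset)
  moreover have "(\<lambda>x. indicator K x *\<^sub>R f x) = f"
    using assms(3) by (auto simp: fun_eq_iff indicator_def)
  ultimately show ?thesis by simp
qed

lemma integral_lborel_translate:
  fixes f :: "'a::euclidean_space \<Rightarrow> real"
  assumes "f \<in> borel_measurable borel"
  shows "(LINT x|lborel. f (a + x)) = (LINT x|lborel. f x)"
proof -
  have "(LINT x|lborel. f x) = (LINT x|distr lborel borel ((+) a). f x)"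
    using lborel_distr_plus[of a] by simp
  also have "\<dots> = (LINT x|lborel. f (a + x))"
    using assms by (subst integral_distr) auto
  finally show ?thesis by simp
qed

text \<open>By translation invariance the integrals of all difference quotients vanish.\<close>

lemma integral_pd_eq_0:
  fixes f :: "'n::finite scalar_field"
  assumes K: "compact K" and f: "times_differentiable 1 f" and 0: "\<And>x. x \<notin> K \<Longrightarrow> f x = 0"
  shows "integrable lborel (pd i f)" and "(LINT x|lborel. pd i f x) = 0"
proof -
  let ?e = "axis i 1 :: real^'n"
  have cl: "closed K" using K by (rule compact_imp_closed)
  have cpd: "continuous_on UNIV (pd i f)"
    using times_differentiable_pd[of 0 f i] f by simp
  have cf: "continuous_on UNIV f"
    using times_differentiable_SucD[of 0 f] f by simp
  have pd0: "pd i f x = 0" if "x \<notin> K" for x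
    by (rule pd_zero_outside[OF cl 0 that])
  show "integrable lborel (pd i f)"
    by (rule integrable_zero_outside_compact[OF K cpd pd0])
  obtain B where B: "\<And>x. \<bar>pd i f x\<bar> \<le> B"
  proof -
    have "bounded (pd i f ` K)"
      using K cpd by (intro compact_imp_bounded compact_continuous_image) (auto intro: continuous_on_subset)
    then obtain B where B: "B > 0" "\<And>x. x \<in> K \<Longrightarrow> \<bar>pd i f x\<bar> \<le> B"
      unfolding bounded_pos by auto
    have "\<bar>pd i f x\<bar> \<le> B" for x
      using B pd0[of x] by (cases "x \<in> K") auto
    then show ?thesis by (rule that)
  qed
  \<comment> \<open>Restricting \<open>f\<close> to a line parallel to the axis turns
    \<open>pd i f\<close> into an ordinary derivative, to which the mean value theorem
    applies.\<close>
  have line: "((\<lambda>t. f (x + t *\<^sub>R ?e)) has_real_derivative pd i f (x + t *\<^sub>R ?e)) (at t)" for x t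
  proof -
    have "(f has_derivative frechet_derivative f (at (x + t *\<^sub>R ?e))) (at (x + t *\<^sub>R ?e))"
      using f by (auto simp: frechet_derivative_works)
    then have D: "((\<lambda>t. f (x + t *\<^sub>R ?e)) has_derivative
        (\<lambda>s. frechet_derivative f (at (x + t *\<^sub>R ?e)) (s *\<^sub>R ?e))) (at t)"
      by (rule has_derivative_compose[rotated]) (auto intro!: derivative_eq_intros)
    have "linear (frechet_derivative f (at (x + t *\<^sub>R ?e)))"
      using f by (intro linear_frechet_derivative) auto
    then have "(\<lambda>s. frechet_derivative f (at (x + t *\<^sub>R ?e)) (s *\<^sub>R ?e)) =
        (*) (pd i f (x + t *\<^sub>R ?e))"
      by (simp add: fun_eq_iff pd_def linear_cmul)
    then show ?thesis
      using D by (simp only: has_field_derivative_def)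
  qed
  \<comment> \<open>Step lengths tending to 0 inside (0, 1]; the common upper bound 1 confines all
    difference quotients to one compact set.\<close>
  define d where "d n = (1 / real (Suc n))" for n
  have d: "0 < d n" "d n \<le> 1" for n by (auto simp: d_def)
  define q where "q n x = (f (x + d n *\<^sub>R ?e) - f x) / d n" for n x
  have q_le: "\<bar>q n x\<bar> \<le> B" for n x
  proof -
    obtain z where "f (x + d n *\<^sub>R ?e) - f (x + 0 *\<^sub>R ?e) = (d n - 0) * pd i f (x + z *\<^sub>R ?e)"
      using MVT2[OF d(1)[of n], of "\<lambda>t. f (x + t *\<^sub>R ?e)" "\<lambda>t. pd i f (x + t *\<^sub>R ?e)"] line by blast
    then have "q n x = pd i f (x + z *\<^sub>R ?e)"
      using d(1)[of n] by (simp add: q_def)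
    then show ?thesis using B by simp
  qed
  \<comment> \<open>\<open>K\<close> swept backwards along \<open>?e\<close> by lengths in [0, 1].
    For \<open>x\<close> outside \<open>C\<close>, neither \<open>x\<close> nor
    \<open>x + d n *\<^sub>R ?e\<close> meets \<open>K\<close>. Hence \<open>B\<close> times the
    indicator of \<open>C\<close> dominates every \<open>q n\<close>.\<close>
  define C where "C = (\<lambda>(y, s). y - s *\<^sub>R ?e) ` (K \<times> {0..1::real})"
  have C: "compact C"
    unfolding C_def using K
    by (intro compact_continuous_image compact_Times) (auto intro!: continuous_intros simp: case_prod_beta)
  have q_0: "q n x = 0" if "x \<notin> C" for n x
  proof -
    have *: "x + s *\<^sub>R ?e \<notin> K" if "0 \<le> s" "s \<le> 1" for s
    proof
      assume "x + s *\<^sub>R ?e \<in> K"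
      then have "(\<lambda>(y, s). y - s *\<^sub>R ?e) (x + s *\<^sub>R ?e, s) \<in> C"
        unfolding C_def using that by (intro imageI) simp
      with \<open>x \<notin> C\<close> show False by simp
    qed
    have "x \<notin> K" "x + d n *\<^sub>R ?e \<notin> K"
      using *[of 0] *[of "d n"] d[of n] by auto
    then show ?thesis using 0 by (simp add: q_def)
  qed
  have "(\<lambda>n. LINT x|lborel. q n x) \<longlonglongrightarrow> (LINT x|lborel. pd i f x)"
  proof (rule integral_dominated_convergence[where w="\<lambda>x. indicator C x *\<^sub>R B"])
    show "pd i f \<in> borel_measurable lborel"
      using cpd by (simp add: borel_measurable_continuous_onI)
    show "q n \<in> borel_measurable lborel" for n
    proof -
      have "continuous_on UNIV (\<lambda>x. f (x + d n *\<^sub>R ?e))"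
        by (rule continuous_on_compose2[OF cf]) (auto intro: continuous_on_add continuous_on_id)
      then have "continuous_on UNIV (q n)"
        unfolding q_def[abs_def] using d(1)[of n] cf
        by (intro continuous_on_divide continuous_on_diff continuous_on_const) auto
      then show ?thesis by (simp add: borel_measurable_continuous_onI)
    qed
    show "integrable lborel (\<lambda>x. indicator C x *\<^sub>R B)"
      using C by (intro borel_integrable_compact continuous_on_const)
    show "AE x in lborel. (\<lambda>n. q n x) \<longlonglongrightarrow> pd i f x"
    proof (rule AE_I2)
      fix x
      have "((\<lambda>t. (f (x + t *\<^sub>R ?e) - f x) / t) \<longlongrightarrow> pd i f x) (at 0)"
        using line[of x 0] by (simp add: has_field_derivative_iff)
      moreover have "filterlim d (at 0) sequentially"
        unfolding filterlim_at d_def using LIMSEQ_inverse_real_of_nat by (simp add: inverse_eq_divide)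
      ultimately show "(\<lambda>n. q n x) \<longlonglongrightarrow> pd i f x"
        unfolding q_def by (rule filterlim_compose)
    qed
    show "AE x in lborel. norm (q n x) \<le> indicator C x *\<^sub>R B" for n
    proof (rule AE_I2)
      show "norm (q n x) \<le> indicator C x *\<^sub>R B" for x
        using q_le[of n x] q_0[of x n] by (cases "x \<in> C") simp_all
    qed
  qed
  moreover have "(LINT x|lborel. q n x) = 0" for n
  proof -
    have mf: "f \<in> borel_measurable borel"
      using cf by (rule borel_measurable_continuous_onI)
    have "integrable lborel f"
      by (rule integrable_zero_outside_compact[OF K cf 0])
    moreover have "integrable lborel (\<lambda>x. f (d n *\<^sub>R ?e + x))"
    proof (rule integrable_zero_outside_compact)
      show "compact ((\<lambda>y. y - d n *\<^sub>R ?e) ` K)"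
        using K by (intro compact_continuous_image continuous_intros)
      show "continuous_on UNIV (\<lambda>x. f (d n *\<^sub>R ?e + x))"
        by (rule continuous_on_compose2[OF cf]) (auto intro: continuous_on_add continuous_on_id)
      show "f (d n *\<^sub>R ?e + x) = 0" if "x \<notin> (\<lambda>y. y - d n *\<^sub>R ?e) ` K" for x
      proof (rule 0)
        show "d n *\<^sub>R ?e + x \<notin> K"
          using that image_eqI[of x "\<lambda>y. y - d n *\<^sub>R ?e" "d n *\<^sub>R ?e + x" K] by auto
      qed
    qed
    ultimately show ?thesis
      using integral_lborel_translate[OF mf, of "d n *\<^sub>R ?e"] by (simp add: q_def add.commute)
  qed
  ultimately show "(LINT x|lborel. pd i f x) = 0"
    by (simp add: LIMSEQ_const_iff)
qed

subsection \<open>The orthonormal frame\<close>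

lemma assumes f: "f differentiable at x" and g: "g differentiable at x"
  shows pd_add: "pd i (\<lambda>y. f y + g y) x = pd i f x + pd i g x"
    and pd_diff: "pd i (\<lambda>y. f y - g y) x = pd i f x - pd i g x"
    and pd_mult: "pd i (\<lambda>y. f y * g y) x = f x * pd i g x + pd i f x * g x"
proof -
  note * = assms[unfolded frechet_derivative_works]
  show "pd i (\<lambda>y. f y + g y) x = pd i f x + pd i g x"
    using pd_eq[OF has_derivative_add[OF *]] by (simp add: pd_def)
  show "pd i (\<lambda>y. f y - g y) x = pd i f x - pd i g x"
    using pd_eq[OF has_derivative_diff[OF *]] by (simp add: pd_def)
  show "pd i (\<lambda>y. f y * g y) x = f x * pd i g x + pd i f x * g x"
    using pd_eq[OF has_derivative_mult[OF *]] by (simp add: pd_def)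
qed

lemma pd_sum:
  assumes "\<And>i. i \<in> I \<Longrightarrow> f i differentiable at x"
  shows "pd k (\<lambda>y. \<Sum>i\<in>I. f i y) x = (\<Sum>i\<in>I. pd k (f i) x)"
proof -
  have "((\<lambda>y. \<Sum>i\<in>I. f i y) has_derivative (\<lambda>v. \<Sum>i\<in>I. frechet_derivative (f i) (at x) v)) (at x)"
    using assms by (intro has_derivative_sum) (simp add: frechet_derivative_works[symmetric])
  from pd_eq[OF this] show ?thesis by (simp add: pd_def)
qed

text \<open>Components of a covariant 2-tensor in the frame \<open>e\<^sub>1\<close>, \<open>e\<^sub>2\<close>, \<open>e\<^sub>3\<close> at a point with \<open>x\<^sub>1 = x\<close>.\<close>

definition nil3_frame :: "real \<Rightarrow> real^3^3 \<Rightarrow> real^3^3" where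
  "nil3_frame x s = (\<chi> a b. \<Sum>i\<in>UNIV. \<Sum>j\<in>UNIV.
     (axis a 1 - (if a = 2 then x else 0) *\<^sub>R axis 3 1) $ i *
     (axis b 1 - (if b = 2 then x else 0) *\<^sub>R axis 3 1) $ j * s $ i $ j)"

lemma nil3_frame_nth:
  "nil3_frame x s $ 1 $ 1 = s $ 1 $ 1"
  "nil3_frame x s $ 1 $ 2 = s $ 1 $ 2 - x * s $ 1 $ 3"
  "nil3_frame x s $ 1 $ 3 = s $ 1 $ 3"
  "nil3_frame x s $ 2 $ 1 = s $ 2 $ 1 - x * s $ 3 $ 1"
  "nil3_frame x s $ 2 $ 2 = (s $ 2 $ 2 - x * s $ 2 $ 3) - x * (s $ 3 $ 2 - x * s $ 3 $ 3)"
  "nil3_frame x s $ 2 $ 3 = s $ 2 $ 3 - x * s $ 3 $ 3"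
  "nil3_frame x s $ 3 $ 1 = s $ 3 $ 1"
  "nil3_frame x s $ 3 $ 2 = s $ 3 $ 2 - x * s $ 3 $ 3"
  "nil3_frame x s $ 3 $ 3 = s $ 3 $ 3"
  by (simp_all add: nil3_frame_def sum_3 axis_def algebra_simps)

lemma nil3_chr_entries:
  "nil3_chr x $ 1 $ 1 $ 1 = 0" "nil3_chr x $ 1 $ 1 $ 2 = 0" "nil3_chr x $ 1 $ 1 $ 3 = 0"
  "nil3_chr x $ 1 $ 2 $ 1 = 0" "nil3_chr x $ 1 $ 2 $ 2 = - x $ 1" "nil3_chr x $ 1 $ 2 $ 3 = - 1/2"
  "nil3_chr x $ 1 $ 3 $ 1 = 0" "nil3_chr x $ 1 $ 3 $ 2 = - 1/2" "nil3_chr x $ 1 $ 3 $ 3 = 0"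
  "nil3_chr x $ 2 $ 1 $ 1 = 0" "nil3_chr x $ 2 $ 1 $ 2 = x $ 1 / 2" "nil3_chr x $ 2 $ 1 $ 3 = 1/2"
  "nil3_chr x $ 2 $ 2 $ 1 = x $ 1 / 2" "nil3_chr x $ 2 $ 2 $ 2 = 0" "nil3_chr x $ 2 $ 2 $ 3 = 0"
  "nil3_chr x $ 2 $ 3 $ 1 = 1/2" "nil3_chr x $ 2 $ 3 $ 2 = 0" "nil3_chr x $ 2 $ 3 $ 3 = 0"
  "nil3_chr x $ 3 $ 1 $ 1 = 0" "nil3_chr x $ 3 $ 1 $ 2 = 1/2 - (x $ 1)\<^sup>2 / 2" "nil3_chr x $ 3 $ 1 $ 3 = - (x $ 1 / 2)"
  "nil3_chr x $ 3 $ 2 $ 1 = 1/2 - (x $ 1)\<^sup>2 / 2" "nil3_chr x $ 3 $ 2 $ 2 = 0" "nil3_chr x $ 3 $ 2 $ 3 = 0"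
  "nil3_chr x $ 3 $ 3 $ 1 = - (x $ 1 / 2)" "nil3_chr x $ 3 $ 3 $ 2 = 0" "nil3_chr x $ 3 $ 3 $ 3 = 0"
  by (simp_all add: nil3_chr_nth doubleton_eq_iff)

text \<open>The connection form: \<open>\<nabla>\<^sub>k e\<^sub>a = \<Sum>\<^sub>c nil3_connection x k $ a $ c \<cdot> e\<^sub>c\<close> where \<open>x = x\<^sub>1\<close>.\<close>

definition nil3_connection :: "real \<Rightarrow> 3 \<Rightarrow> real^3^3" where
  "nil3_connection x k = (if k = 1 then (1/2) *\<^sub>R (axis 3 1 \<otimes> axis 2 1 - axis 2 1 \<otimes> axis 3 1)
     else if k = 2 then (x/2) *\<^sub>R (axis 1 1 \<otimes> axis 2 1 - axis 2 1 \<otimes> axis 1 1)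
       + (1/2) *\<^sub>R (axis 1 1 \<otimes> axis 3 1 - axis 3 1 \<otimes> axis 1 1)
     else (1/2) *\<^sub>R (axis 1 1 \<otimes> axis 2 1 - axis 2 1 \<otimes> axis 1 1))"

lemma nil3_connection_antisym: "nil3_connection x k $ a $ c = - nil3_connection x k $ c $ a"
  by (simp add: nil3_connection_def tensor_prod_def algebra_simps)

lemma nil3_connection_entries:
  "nil3_connection x 1 $ 1 $ 1 = 0" "nil3_connection x 1 $ 1 $ 2 = 0" "nil3_connection x 1 $ 1 $ 3 = 0"
  "nil3_connection x 1 $ 2 $ 1 = 0" "nil3_connection x 1 $ 2 $ 2 = 0" "nil3_connection x 1 $ 2 $ 3 = -1/2"
  "nil3_connection x 1 $ 3 $ 1 = 0" "nil3_connection x 1 $ 3 $ 2 = 1/2" "nil3_connection x 1 $ 3 $ 3 = 0"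
  "nil3_connection x 2 $ 1 $ 1 = 0" "nil3_connection x 2 $ 1 $ 2 = x/2" "nil3_connection x 2 $ 1 $ 3 = 1/2"
  "nil3_connection x 2 $ 2 $ 1 = -x/2" "nil3_connection x 2 $ 2 $ 2 = 0" "nil3_connection x 2 $ 2 $ 3 = 0"
  "nil3_connection x 2 $ 3 $ 1 = -1/2" "nil3_connection x 2 $ 3 $ 2 = 0" "nil3_connection x 2 $ 3 $ 3 = 0"
  "nil3_connection x 3 $ 1 $ 1 = 0" "nil3_connection x 3 $ 1 $ 2 = 1/2" "nil3_connection x 3 $ 1 $ 3 = 0"
  "nil3_connection x 3 $ 2 $ 1 = -1/2" "nil3_connection x 3 $ 2 $ 2 = 0" "nil3_connection x 3 $ 2 $ 3 = 0"
  "nil3_connection x 3 $ 3 $ 1 = 0" "nil3_connection x 3 $ 3 $ 2 = 0" "nil3_connection x 3 $ 3 $ 3 = 0"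
  by (simp_all add: nil3_connection_def tensor_prod_def axis_def)

lemma pd_coord: "pd i (\<lambda>y. y $ k) x = (if i = k then 1 else 0)"
  by (simp add: pd_basic axis_def)

lemma differentiable_coord: "(\<lambda>y::real^'n::finite. y $ k) differentiable at x"
  by (intro bounded_linear_imp_differentiable bounded_linear_vec_nth)

text \<open>This is the Leibniz rule for h(e_a, e_b): differentiating gives the frame components of
  \<nabla>h plus the terms in which \<nabla>_k hits e_a or e_b, and these are expressed by the
  connection form.\<close>

lemma pd_nil3_frame:
  assumes d: "\<And>i j. (\<lambda>y. s y $ i $ j) differentiable at x"
  shows "\<forall>k a b. pd k (\<lambda>y. nil3_frame (y $ 1) (s y) $ a $ b) x =
    nil3_frame (x $ 1) (nabla2 nil3_metric s x $ k) $ a $ b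
    + (\<Sum>c\<in>UNIV. nil3_connection (x $ 1) k $ a $ c * nil3_frame (x $ 1) (s x) $ c $ b
        + nil3_connection (x $ 1) k $ b $ c * nil3_frame (x $ 1) (s x) $ a $ c)"
  apply (simp only: forall_3)
  apply (intro conjI; simp only: nil3_frame_nth sum_3 nil3_connection_entries nabla2_def christoffel_nil3 nil3_chr_entries vec_lambda_beta
    pd_diff pd_mult d differentiable_coord differentiable_diff differentiable_mult pd_coord)
  apply (simp_all add: algebra_simps power2_eq_square)
  done

text \<open>The frame is orthonormal, so the metric contraction becomes a Euclidean sum of products,
  from which nonnegativity can be read off.\<close>

lemma inner2_nil3:
  "inner2 nil3_metric s h x = (\<Sum>a\<in>UNIV. \<Sum>b\<in>UNIV.
     nil3_frame (x $ 1) (s x) $ a $ b * nil3_frame (x $ 1) (h x) $ a $ b)"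
  apply (simp only: inner2_def metric_inv_nil3 sum_3 nil3_inv_nth nil3_frame_nth)
  apply (simp add: algebra_simps power2_eq_square)
  done

lemma inner2_nil3_nonneg: "0 \<le> inner2 nil3_metric h h x"
  by (auto simp: inner2_nil3 intro!: sum_nonneg)

text \<open>Only the first slot is passed to the orthonormal frame; the middle term is the slot
  evaluated on e_2 = \<partial>_2 - x_1 \<partial>_3.\<close>

lemma inner3_nil3:
  "inner3 nil3_metric s s x = inner2 nil3_metric (\<lambda>y. s y $ 1) (\<lambda>y. s y $ 1) x
   + inner2 nil3_metric (\<lambda>y. s y $ 2 - y $ 1 *\<^sub>R s y $ 3) (\<lambda>y. s y $ 2 - y $ 1 *\<^sub>R s y $ 3) x
   + inner2 nil3_metric (\<lambda>y. s y $ 3) (\<lambda>y. s y $ 3) x"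
  unfolding inner2_def inner3_def metric_inv_nil3 sum_3 nil3_inv_nth
  apply (simp add: algebra_simps power2_eq_square)
  done

lemma inner3_nil3_nonneg: "0 \<le> inner3 nil3_metric t t x"
  unfolding inner3_nil3 by (intro add_nonneg_nonneg inner2_nil3_nonneg)

text \<open>Metric compatibility amounts to the antisymmetry of the connection form.\<close>

lemma pd_inner2_nil3:
  assumes s: "\<And>i j. (\<lambda>y. s y $ i $ j) differentiable at x"
    and h: "\<And>i j. (\<lambda>y. h y $ i $ j) differentiable at x"
  shows "pd k (inner2 nil3_metric s h) x =
     inner2 nil3_metric (\<lambda>y. nabla2 nil3_metric s y $ k) h x
   + inner2 nil3_metric s (\<lambda>y. nabla2 nil3_metric h y $ k) x"
proof -
  define w where "w = nil3_connection (x $ 1) k"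
  have D: "(\<lambda>y. nil3_frame (y $ 1) (s y) $ a $ b) differentiable at x"
    if s: "\<And>i j. (\<lambda>y. s y $ i $ j) differentiable at x" for s :: "3 tensor2_field" and a b
  proof -
    have "\<forall>a b. (\<lambda>y. nil3_frame (y $ 1) (s y) $ a $ b) differentiable at x"
      by (simp add: forall_3 nil3_frame_nth differentiable_diff differentiable_mult differentiable_coord s)
    then show ?thesis by blast
  qed
  note P = pd_nil3_frame[rule_format]
  have "pd k (inner2 nil3_metric s h) x = (\<Sum>a\<in>UNIV. \<Sum>b\<in>UNIV.
      pd k (\<lambda>y. nil3_frame (y $ 1) (s y) $ a $ b * nil3_frame (y $ 1) (h y) $ a $ b) x)"
    unfolding inner2_nil3[abs_def]
    by (simp add: pd_sum differentiable_sum differentiable_mult D s h)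
  also have "\<dots> = inner2 nil3_metric (\<lambda>y. nabla2 nil3_metric s y $ k) h x
   + inner2 nil3_metric s (\<lambda>y. nabla2 nil3_metric h y $ k) x"
    \<comment> \<open>The diagonal instances of antisymmetry force the diagonal of the connection
      form to vanish; the others let its terms cancel in pairs.\<close>
    unfolding inner2_nil3 pd_mult[OF D[OF s] D[OF h]] P[OF s] P[OF h]
    using nil3_connection_antisym[of "x $ 1" k 1 1] nil3_connection_antisym[of "x $ 1" k 2 2]
      nil3_connection_antisym[of "x $ 1" k 3 3] nil3_connection_antisym[of "x $ 1" k 2 1]
      nil3_connection_antisym[of "x $ 1" k 3 1] nil3_connection_antisym[of "x $ 1" k 3 2]
    unfolding w_def[symmetric] sum_3
    by (simp add: algebra_simps)
  finally show ?thesis .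
qed

text \<open>\<open>P p q\<close> is dx_p \<and> dx_q. With the coframe \<theta>_1 = dx_1, \<theta>_2
  = dx_2, \<theta>_3 = x_1 dx_2 + dx_3, the formula is the diagonal form with coefficients 3/4,
  -1/4, -1/4 on \<theta>_1 \<and> \<theta>_2, \<theta>_1 \<and> \<theta>_3, \<theta>_2 \<and>
  \<theta>_3, expanded in coordinates. The coefficients are minus the sectional curvatures, since
  R_ijji involves P(i,j) P(j,i) = -1.\<close>

lemma riemann_nil3: "\<forall>i j k l. riemann nil3_metric x $ i $ j $ k $ l =
   (let P = (\<lambda>p q. axis p 1 \<otimes> axis q 1 - axis q 1 \<otimes> axis p 1) :: 3 \<Rightarrow> 3 \<Rightarrow> real^3^3 in
     (3/4 - (x $ 1)\<^sup>2/4) * P 1 2 $ i $ j * P 1 2 $ k $ l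
     - x $ 1 / 4 * (P 1 2 $ i $ j * P 1 3 $ k $ l + P 1 3 $ i $ j * P 1 2 $ k $ l)
     - 1/4 * P 1 3 $ i $ j * P 1 3 $ k $ l - 1/4 * P 2 3 $ i $ j * P 2 3 $ k $ l)"
  apply (simp only: riemann_def curvature_op_def christoffel_nil3 pd_chr vec_lambda_beta)
  apply (simp only: forall_3 sum_3 nil3_metric_nth nil3_chr_entries mult_zero_left mult_1_left add_0_left add_0_right)
  apply (simp add: doubleton_eq_iff tensor_prod_def axis_def Let_def)
  apply (simp add: field_simps power2_eq_square)
  done

subsection \<open>The zeroth-order terms\<close>

lemma inner2_raise2: "inner2 g s h x = (\<Sum>i\<in>UNIV. \<Sum>j\<in>UNIV. s x $ i $ j * raise2 g h x $ i $ j)"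
  by (simp add: inner2_def raise2_def sum_distrib_left mult_ac)

lemma ricci_nil3_entries:
  "ricci nil3_metric x $ 1 $ 1 = - 1/2" "ricci nil3_metric x $ 1 $ 2 = 0" "ricci nil3_metric x $ 1 $ 3 = 0"
  "ricci nil3_metric x $ 2 $ 1 = 0" "ricci nil3_metric x $ 2 $ 2 = (x $ 1)\<^sup>2 / 2 - 1/2" "ricci nil3_metric x $ 2 $ 3 = x $ 1 / 2"
  "ricci nil3_metric x $ 3 $ 1 = 0" "ricci nil3_metric x $ 3 $ 2 = x $ 1 / 2" "ricci nil3_metric x $ 3 $ 3 = 1/2"
  by (simp_all add: ricci_nil3 doubleton_eq_iff)

text \<open>What remains of \<open>L\<close> in order zero once \<open>X\<^sup>k \<partial>\<^sub>k\<close> in the Lie derivative is replaced by \<open>X\<^sup>k \<nabla>\<^sub>k\<close>.\<close>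

definition nil3_potential :: "3 tensor2_field \<Rightarrow> 3 tensor2_field" where
  "nil3_potential h x = (\<chi> i j.
     2 * (\<Sum>p\<in>UNIV. \<Sum>q\<in>UNIV. riemann nil3_metric x $ i $ p $ q $ j * raise2 nil3_metric h x $ p $ q)
     - (\<Sum>k\<in>UNIV. ricci_mixed nil3_metric x $ i $ k * h x $ k $ j)
     - (\<Sum>k\<in>UNIV. ricci_mixed nil3_metric x $ j $ k * h x $ i $ k)
     - (\<Sum>k\<in>UNIV. nil3_field x $ k * ((\<Sum>m\<in>UNIV. nil3_chr x $ m $ k $ i * h x $ m $ j)
                                    + (\<Sum>m\<in>UNIV. nil3_chr x $ m $ k $ j * h x $ i $ m))
         + h x $ k $ j * pd i (\<lambda>y. nil3_field y $ k) x
         + h x $ i $ k * pd j (\<lambda>y. nil3_field y $ k) x)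
     - 3 * h x $ i $ j)"

lemma pd_nil3_field: "pd i (\<lambda>y. nil3_field y $ k) x = (if i = k then if k = 3 then -2 else -1 else 0)"
proof -
  have "\<forall>i k. pd i (\<lambda>y. nil3_field y $ k) x = (if i = k then if k = 3 then -2 else -1 else 0)"
    by (simp only: forall_3 nil3_field_nth pd_basic) (simp add: axis_def)
  then show ?thesis by blast
qed

text \<open>Separates the second- and first-order parts, which are integrated by parts, from a
  pointwise algebraic term.\<close>

lemma linearized_flow_nil3:
  "linearized_flow nil3_metric nil3_field 3 h x = rough_laplacian nil3_metric h x
     - (\<Sum>k\<in>UNIV. nil3_field x $ k *\<^sub>R nabla2 nil3_metric h x $ k) + nil3_potential h x"
  by (simp add: linearized_flow_def vec_eq_iff lichnerowicz_laplacian_def lie_derivative_def nabla2_def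
      nil3_potential_def christoffel_nil3 sum.distrib algebra_simps sum_subtractf)

lemma inner2_nil3_potential_le:
  assumes "symmetric_tensor h"
  shows "inner2 nil3_metric (nil3_potential h) h x \<le> 3/2 * inner2 nil3_metric h h x"
proof -
  define t where "t = x $ 1"
  \<comment> \<open>\<open>a\<close>, \<open>b\<close>, \<open>c\<close>, \<open>d\<close>,
    \<open>e\<close>, \<open>f\<close> are the frame components h_11, h_12, h_13, h_22, h_23, h_33;
    by symmetry they determine \<open>h\<close> at \<open>x\<close>.\<close>
  define a where "a = h x $ 1 $ 1"
  define b where "b = h x $ 1 $ 2 - t * h x $ 1 $ 3"
  define c where "c = h x $ 1 $ 3"
  define e where "e = h x $ 2 $ 3 - t * h x $ 3 $ 3"
  define f where "f = h x $ 3 $ 3"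
  define d where "d = h x $ 2 $ 2 - 2 * t * h x $ 2 $ 3 + t\<^sup>2 * h x $ 3 $ 3"
  have h: "h x $ 1 $ 1 = a" "h x $ 1 $ 2 = b + t * c" "h x $ 1 $ 3 = c"
    "h x $ 2 $ 1 = b + t * c" "h x $ 2 $ 2 = d + 2 * t * e + t\<^sup>2 * f" "h x $ 2 $ 3 = e + t * f"
    "h x $ 3 $ 1 = c" "h x $ 3 $ 2 = e + t * f" "h x $ 3 $ 3 = f"
    using assms unfolding symmetric_tensor_def a_def b_def c_def d_def e_def f_def
    by (auto simp: algebra_simps power2_eq_square)
  have inv: "nil3_inv x $ 1 $ 1 = 1" "nil3_inv x $ 1 $ 2 = 0" "nil3_inv x $ 1 $ 3 = 0"
  "nil3_inv x $ 2 $ 1 = 0" "nil3_inv x $ 2 $ 2 = 1" "nil3_inv x $ 2 $ 3 = - t"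
  "nil3_inv x $ 3 $ 1 = 0" "nil3_inv x $ 3 $ 2 = - t" "nil3_inv x $ 3 $ 3 = 1 + t\<^sup>2"
    by (simp_all add: nil3_inv_nth t_def)
  define U where "U = raise2 nil3_metric h x"
  have U: "U $ 1 $ 1 = a" "U $ 1 $ 2 = b" "U $ 1 $ 3 = c - t * b"
    "U $ 2 $ 1 = b" "U $ 2 $ 2 = d" "U $ 2 $ 3 = e - t * d"
    "U $ 3 $ 1 = c - t * b" "U $ 3 $ 2 = e - t * d" "U $ 3 $ 3 = f - 2 * t * e + t\<^sup>2 * d"
    unfolding U_def raise2_def metric_inv_nil3 sum_3 vec_lambda_beta inv h
    by (simp_all add: algebra_simps power2_eq_square)
  have N: "inner2 nil3_metric h h x = a\<^sup>2 + d\<^sup>2 + f\<^sup>2 + 2 * b\<^sup>2 + 2 * c\<^sup>2 + 2 * e\<^sup>2"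
    unfolding inner2_raise2 U_def[symmetric] sum_3 U h
    by (simp add: algebra_simps power2_eq_square)
  \<comment> \<open>This is 2 (K_12 (ad - b^2) + K_13 (af - c^2) + K_23 (df - e^2)) with sectional
    curvatures K_12 = -3/4 and K_13 = K_23 = 1/4.\<close>
  have R: "(\<Sum>i\<in>UNIV. \<Sum>j\<in>UNIV. (\<Sum>p\<in>UNIV. \<Sum>q\<in>UNIV. riemann nil3_metric x $ i $ p $ q $ j * U $ p $ q) * U $ i $ j)
      = (3 * b\<^sup>2 - c\<^sup>2 - e\<^sup>2 - 3 * a * d + a * f + d * f) / 2"
    unfolding riemann_nil3[rule_format] Let_def sum_3 U t_def[symmetric]
    apply (simp add: tensor_prod_def axis_def)
    apply (simp add: field_simps power2_eq_square)
    done
  define V where "V = (\<chi> i j. - (\<Sum>k\<in>UNIV. ricci_mixed nil3_metric x $ i $ k * h x $ k $ j)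
     - (\<Sum>k\<in>UNIV. ricci_mixed nil3_metric x $ j $ k * h x $ i $ k)
     - (\<Sum>k\<in>UNIV. nil3_field x $ k * ((\<Sum>m\<in>UNIV. nil3_chr x $ m $ k $ i * h x $ m $ j)
                                    + (\<Sum>m\<in>UNIV. nil3_chr x $ m $ k $ j * h x $ i $ m))
         + h x $ k $ j * pd i (\<lambda>y. nil3_field y $ k) x
         + h x $ i $ k * pd j (\<lambda>y. nil3_field y $ k) x)
     - 3 * h x $ i $ j)"
  have ric: "ricci_mixed nil3_metric x $ 1 $ 1 = -1/2" "ricci_mixed nil3_metric x $ 1 $ 2 = 0" "ricci_mixed nil3_metric x $ 1 $ 3 = 0"
    "ricci_mixed nil3_metric x $ 2 $ 1 = 0" "ricci_mixed nil3_metric x $ 2 $ 2 = -1/2" "ricci_mixed nil3_metric x $ 2 $ 3 = t"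
    "ricci_mixed nil3_metric x $ 3 $ 1 = 0" "ricci_mixed nil3_metric x $ 3 $ 2 = 0" "ricci_mixed nil3_metric x $ 3 $ 3 = 1/2"
    unfolding ricci_mixed_def metric_inv_nil3 vec_lambda_beta sum_3 inv ricci_nil3_entries t_def[symmetric]
    by (simp_all add: field_simps power2_eq_square)
  \<comment> \<open>The antisymmetric part of \<nabla>X drops out against the symmetric
    \<open>h\<close>. By the soliton equation its symmetric part is -Rc - (3/2) g, which cancels the
    Ricci terms and -3h. The cancellation is verified here by expansion.\<close>
  have V: "(\<Sum>i\<in>UNIV. \<Sum>j\<in>UNIV. V $ i $ j * U $ i $ j) = 0"
    unfolding V_def vec_lambda_beta
    apply (simp only: sum_3 ric h U pd_nil3_field nil3_field_nth nil3_chr_entries t_def[symmetric])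
    apply simp
    apply (simp add: field_simps power2_eq_square)
    done
  define S where "S = (\<lambda>i j. \<Sum>p\<in>UNIV. \<Sum>q\<in>UNIV. riemann nil3_metric x $ i $ p $ q $ j * U $ p $ q)"
  have pot: "nil3_potential h x $ i $ j = 2 * S i j + V $ i $ j" for i j
    by (simp add: nil3_potential_def V_def U_def S_def)
  have "inner2 nil3_metric (nil3_potential h) h x =
      2 * (\<Sum>i\<in>UNIV. \<Sum>j\<in>UNIV. S i j * U $ i $ j) + (\<Sum>i\<in>UNIV. \<Sum>j\<in>UNIV. V $ i $ j * U $ i $ j)"
    unfolding inner2_raise2 U_def[symmetric] pot
    by (simp add: ring_distribs sum.distrib sum_distrib_left mult.assoc)
  \<comment> \<open>The terms 3 b^2 cancel exactly, and the remainder vanishes when a + d = f = c =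
    e = 0, so 3/2 is the best pointwise constant.\<close>
  also have "\<dots> = 3/2 * inner2 nil3_metric h h x - ((a + d)\<^sup>2 + f\<^sup>2 + (a + d - f)\<^sup>2 / 2 + 4 * c\<^sup>2 + 4 * e\<^sup>2)"
    unfolding S_def R V N by (simp add: field_simps power2_eq_square)
  also have "\<dots> \<le> 3/2 * inner2 nil3_metric h h x"
    using zero_le_power2[of "a + d"] zero_le_power2[of f] zero_le_power2[of "a + d - f"]
      zero_le_power2[of c] zero_le_power2[of e] by linarith
  finally show ?thesis .
qed

subsection \<open>Pointwise identity and integration\<close>

lemma inner2_cong: "s x = s' x \<Longrightarrow> h x = h' x \<Longrightarrow> inner2 g s h x = inner2 g s' h' x"
  by (simp add: inner2_def)

lemma inner2_nil3_commute: "inner2 nil3_metric s h x = inner2 nil3_metric h s x"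
  by (simp add: inner2_nil3 mult.commute)

lemma inner2_zero_right: "h x = 0 \<Longrightarrow> inner2 g s h x = 0"
  by (simp add: inner2_def)

text \<open>Freezing the first slot as a label reduces the second covariant derivative to
  \<open>nabla2\<close> of each slice, so metric compatibility for 2-tensors can be reused.\<close>

lemma nabla3_eq:
  "nabla3 g t x $ l $ k = nabla2 g (\<lambda>y. t y $ k) x $ l - (\<Sum>m\<in>UNIV. christoffel g x $ m $ l $ k *\<^sub>R t x $ m)"
  by (simp add: nabla3_def nabla2_def vec_eq_iff)

text \<open>The coordinates are harmonic: \<open>g\<^sup>l\<^sup>k \<Gamma>\<^sup>m\<^sub>l\<^sub>k = 0\<close>, so no correction term appears.\<close>

lemma rough_laplacian_nil3:
  fixes h :: "3 tensor2_field" and x :: "real^3"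
  defines "T \<equiv> \<lambda>l k. nabla2 nil3_metric (\<lambda>y. nabla2 nil3_metric h y $ k) x $ l"
  shows "rough_laplacian nil3_metric h x =
    T 1 1 + T 2 2 - x $ 1 *\<^sub>R T 2 3 - x $ 1 *\<^sub>R T 3 2 + (1 + (x $ 1)\<^sup>2) *\<^sub>R T 3 3"
  unfolding vec_eq_iff rough_laplacian_def nabla3_eq T_def metric_inv_nil3 christoffel_nil3
    sum_3 nil3_inv_nth nil3_chr_entries vec_lambda_beta
  by (simp add: algebra_simps power2_eq_square)

section \<open>Regularity of the coefficients and integrands, and the volume measure\<close>

lemma times_differentiable_nil3_inv: "times_differentiable n (\<lambda>x. nil3_inv x $ i $ j)"
proof -
  have "\<forall>i j. times_differentiable n (\<lambda>x. nil3_inv x $ i $ j)"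
    by (simp add: forall_3 nil3_inv_nth times_differentiable_intros)
  then show ?thesis by blast
qed

lemma times_differentiable_nil3_chr: "times_differentiable n (\<lambda>x. nil3_chr x $ l $ i $ j)"
proof -
  have "\<forall>l i j. times_differentiable n (\<lambda>x. nil3_chr x $ l $ i $ j)"
    by (simp add: forall_3 nil3_chr_entries times_differentiable_intros)
  then show ?thesis by blast
qed

lemma times_differentiable_nil3_field: "times_differentiable n (\<lambda>x. nil3_field x $ i)"
proof -
  have "\<forall>i. times_differentiable n (\<lambda>x. nil3_field x $ i)"
    by (simp add: forall_3 nil3_field_nth times_differentiable_intros)
  then show ?thesis by blast
qed

lemma times_differentiable_nil3_ricci: "times_differentiable n (\<lambda>x. ricci nil3_metric x $ i $ j)"
proof -
  have "\<forall>i j. times_differentiable n (\<lambda>x. ricci nil3_metric x $ i $ j)"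
    by (simp add: forall_3 ricci_nil3_entries times_differentiable_intros)
  then show ?thesis by blast
qed

lemma times_differentiable_nil3_riemann:
  "times_differentiable n (\<lambda>x. riemann nil3_metric x $ i $ j $ k $ l)"
  unfolding riemann_nil3[rule_format] Let_def
  by (intro times_differentiable_intros)

lemmas times_differentiable_nil3 = times_differentiable_intros times_differentiable_nil3_inv
  times_differentiable_nil3_chr times_differentiable_nil3_field times_differentiable_nil3_ricci
  times_differentiable_nil3_riemann

lemma times_differentiable_inner2_nil3:
  assumes "\<And>i j. times_differentiable n (\<lambda>x. s x $ i $ j)" "\<And>i j. times_differentiable n (\<lambda>x. h x $ i $ j)"
  shows "times_differentiable n (inner2 nil3_metric s h)"
  unfolding inner2_def[abs_def] metric_inv_nil3 by (intro times_differentiable_nil3 assms)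

lemma times_differentiable_inner3_nil3:
  assumes "\<And>i j k. times_differentiable n (\<lambda>x. t x $ i $ j $ k)"
  shows "times_differentiable n (inner3 nil3_metric t t)"
  unfolding inner3_def[abs_def] metric_inv_nil3 by (intro times_differentiable_nil3 assms)

lemma times_differentiable_nabla2_nil3:
  assumes h: "\<And>i j. times_differentiable (Suc n) (\<lambda>x. h x $ i $ j)"
  shows "times_differentiable n (\<lambda>x. nabla2 nil3_metric h x $ k $ i $ j)"
  unfolding nabla2_def christoffel_nil3 vec_lambda_beta
  by (intro times_differentiable_nil3 times_differentiable_SucD[OF h] times_differentiable_pd[OF h])

lemma times_differentiable_linearized_flow_nil3:
  assumes h: "\<And>n i j. times_differentiable n (\<lambda>x. h x $ i $ j)"
  shows "times_differentiable n (\<lambda>x. linearized_flow nil3_metric nil3_field 3 h x $ i $ j)"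
  unfolding linearized_flow_nil3 rough_laplacian_nil3 nil3_potential_def raise2_def ricci_mixed_def
    metric_inv_nil3 pd_nil3_field vec_lambda_beta vector_add_component vector_minus_component
    vector_scaleR_component sum_component real_scaleR_def
  by (intro times_differentiable_nil3 times_differentiable_nabla2_nil3 h)

text \<open>The determinant is (1 + x_1^2) - x_1^2 = 1, so the Riemannian divergence is the
  coordinate divergence and no density enters the integration by parts.\<close>

lemma volume_measure_nil3: "volume_measure nil3_metric = lborel"
proof -
  have "det (nil3_metric x) = 1" for x
    by (simp add: det_3 nil3_metric_nth power2_eq_square)
  then show ?thesis by (simp add: volume_measure_def density_1)
qed

theorem proposition4:
  fixes h :: "3 tensor2_field"
  assumes "smooth h"
    and "compactly_supported h"
    and "symmetric_tensor h"
  shows "(LINT x|volume_measure nil3_metric.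
            inner2 nil3_metric (linearized_flow nil3_metric nil3_field 3 h) h x)
         \<le> - (L2_norm3 nil3_metric (nabla2 nil3_metric h))\<^sup>2
           - (1/2) * (L2_norm2 nil3_metric h)\<^sup>2"
proof -
  define K where "K = closure (support_on UNIV h)"
  have K: "compact K" using assms(2) by (simp add: K_def compactly_supported_def)
  have h0: "h x = 0" if "x \<notin> K" for x
    using that closure_subset[of "support_on UNIV h"] by (auto simp: K_def in_support_on)
  have td: "times_differentiable n (\<lambda>x. h x $ i $ j)" for n i j
    using assms(1) by (intro times_differentiable_vec_nth) (simp add: smooth_def)
  define t where "t = nabla2 nil3_metric h"
  have td_t: "times_differentiable n (\<lambda>x. t x $ k $ i $ j)" for n k i j
    unfolding t_def by (rule times_differentiable_nabla2_nil3[OF td])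
  have t0: "t x = 0" if "x \<notin> K" for x
  proof -
    have "pd k (\<lambda>y. h y $ i $ j) x = 0" for k i j
      using that by (rule pd_zero_outside[OF compact_imp_closed[OF K], rotated]) (simp add: h0)
    then show ?thesis using h0[OF that] by (simp add: t_def nabla2_def vec_eq_iff)
  qed
  \<comment> \<open>\<open>F\<^sup>k = g\<^sup>k\<^sup>l \<langle>\<nabla>\<^sub>l h, h\<rangle> - X\<^sup>k |h|\<^sup>2 / 2\<close> is the vector field whose divergence integrates to 0.\<close>
  define W where "W k = inner2 nil3_metric (\<lambda>y. t y $ k) h" for k
  define N where "N = inner2 nil3_metric h h"
  \<comment> \<open>The components of -X/2 are x_1/2, x_2/2 and x_3: the first two carry |h|^2/2,
    the third |h|^2 itself.\<close>
  define M where "M = (\<lambda>y. 1/2 * N y)"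
  define G where "G = inner3 nil3_metric t t"
  define F where "F k = (if k = 1 then \<lambda>y. W 1 y + y $ 1 * M y
    else if k = 2 then \<lambda>y. W 2 y - y $ 1 * W 3 y + y $ 2 * M y
    else (\<lambda>y. W 3 y + y $ 1 * (y $ 1 * W 3 y - W 2 y) + y $ 3 * N y))" for k :: 3
  have td_W: "times_differentiable n (W k)" for n k
    unfolding W_def by (rule times_differentiable_inner2_nil3[OF td_t td])
  have td_N: "times_differentiable n N" for n
    unfolding N_def by (rule times_differentiable_inner2_nil3[OF td td])
  have td_M: "times_differentiable n M" for n
    unfolding M_def by (intro times_differentiable_intros td_N)
  have td_G: "times_differentiable n G" for n
    unfolding G_def by (rule times_differentiable_inner3_nil3[OF td_t])
  have td_F: "times_differentiable n (F k)" for n k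
    unfolding F_def by (simp add: times_differentiable_intros td_W td_N td_M)
  have WN0: "W k x = 0" "N x = 0" if "x \<notin> K" for k x
    using h0[OF that] by (simp_all add: W_def N_def inner2_zero_right)
  have F0: "F k x = 0" if "x \<notin> K" for k x
    using WN0[OF that] by (simp add: F_def M_def)
  have G0: "G x = 0" if "x \<notin> K" for x
    using t0[OF that] by (simp add: G_def inner3_def)
  have diff: "f differentiable at x" if "\<And>n. times_differentiable n f" for f :: "3 scalar_field" and x
    using that[of 1] by simp
  have pdN: "pd k N x = 2 * W k x" for k x
    unfolding N_def pd_inner2_nil3[OF diff[OF td] diff[OF td]]
    by (simp add: W_def t_def inner2_nil3_commute[of h])
  have pdM: "pd k M x = W k x" for k x
    unfolding M_def pd_mult[OF differentiable_const diff[OF td_N]] pd_basic(1) pdN by simp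
  define T where "T l k x = nabla2 nil3_metric (\<lambda>y. t y $ k) x $ l" for l k x
  have pdW: "pd l (W k) x = inner2 nil3_metric (T l k) h x
      + inner2 nil3_metric (\<lambda>y. t y $ k) (\<lambda>y. t y $ l) x" for l k x
    unfolding W_def pd_inner2_nil3[OF diff[OF td_t] diff[OF td]] by (simp add: T_def[abs_def] t_def)
  let ?L = "linearized_flow nil3_metric nil3_field 3 h"
  note dW = diff[OF td_W] and dN = diff[OF td_N] and dM = diff[OF td_M]
  \<comment> \<open>Pointwise, <Lh, h> is div F - |\<nabla>h|^2 - 2 |h|^2 plus the potential term,
    which is at most (3/2) |h|^2; this leaves -1/2.\<close>
  have le: "inner2 nil3_metric ?L h x \<le> pd 1 (F 1) x + pd 2 (F 2) x + pd 3 (F 3) x - G x - 1/2 * N x" for x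
  proof -
    \<comment> \<open>The summand \<open>2 * N x\<close> is |h|^2 times div(-X/2) = 1/2 + 1/2 +
      1.\<close>
    have F: "pd 1 (F 1) x + pd 2 (F 2) x + pd 3 (F 3) x =
        pd 1 (W 1) x + (pd 2 (W 2) x - x $ 1 * pd 2 (W 3) x)
        + (pd 3 (W 3) x + x $ 1 * (x $ 1 * pd 3 (W 3) x - pd 3 (W 2) x))
        + 2 * N x + (x $ 1 * W 1 x + x $ 2 * W 2 x + 2 * x $ 3 * W 3 x)"
      unfolding F_def
      by (simp add: pd_add pd_diff pd_mult pd_coord differentiable_coord dW dN dM
          differentiable_add differentiable_diff differentiable_mult pdN pdM)
        (simp add: M_def algebra_simps)
    have L: "inner2 nil3_metric ?L h x =
      inner2 nil3_metric (T 1 1) h x + inner2 nil3_metric (T 2 2) h x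
       - x $ 1 * inner2 nil3_metric (T 2 3) h x - x $ 1 * inner2 nil3_metric (T 3 2) h x
       + (1 + (x $ 1)\<^sup>2) * inner2 nil3_metric (T 3 3) h x
       + (x $ 1 * W 1 x + x $ 2 * W 2 x + 2 * x $ 3 * W 3 x)
       + inner2 nil3_metric (nil3_potential h) h x"
    proof -
      \<comment> \<open>At the fixed point \<open>x\<close>, pairing with \<open>h\<close> is a
        linear functional of the matrix value alone, so it can be distributed over the decomposition
        of \<open>?L\<close>.\<close>
      define q where "q A = inner2 nil3_metric (\<lambda>_. A) h x" for A
      have q: "inner2 nil3_metric s h x = q (s x)" for s
        unfolding q_def by (rule inner2_cong) simp_all
      have q_linear: "q (A + B) = q A + q B" "q (A - B) = q A - q B" "q (c *\<^sub>R A) = c * q A" for A B c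
        by (simp_all add: q_def inner2_raise2 sum.distrib sum_subtractf sum_distrib_left algebra_simps)
      show ?thesis
        unfolding W_def q linearized_flow_nil3 rough_laplacian_nil3 T_def t_def sum_3 nil3_field_nth q_linear
        by simp
    qed
    have G: "G x = inner2 nil3_metric (\<lambda>y. t y $ 1) (\<lambda>y. t y $ 1) x
       + inner2 nil3_metric (\<lambda>y. t y $ 2) (\<lambda>y. t y $ 2) x
       - x $ 1 * inner2 nil3_metric (\<lambda>y. t y $ 2) (\<lambda>y. t y $ 3) x
       - x $ 1 * inner2 nil3_metric (\<lambda>y. t y $ 3) (\<lambda>y. t y $ 2) x
       + (1 + (x $ 1)\<^sup>2) * inner2 nil3_metric (\<lambda>y. t y $ 3) (\<lambda>y. t y $ 3) x"
      unfolding G_def inner3_def inner2_def metric_inv_nil3 sum_3 nil3_inv_nth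
      by (simp add: algebra_simps power2_eq_square)
    show ?thesis
      using inner2_nil3_potential_le[OF assms(3), of x]
      unfolding F L G pdW N_def[symmetric] by (simp add: algebra_simps power2_eq_square)
  qed
  have cont: "continuous_on UNIV f" if "\<And>n. times_differentiable n f" for f :: "3 scalar_field"
    using that[of 0] by simp
  note int_F = integral_pd_eq_0[OF K td_F F0]
  have int_N: "integrable lborel N"
    by (rule integrable_zero_outside_compact[OF K cont[OF td_N] WN0(2)])
  have int_G: "integrable lborel G"
    by (rule integrable_zero_outside_compact[OF K cont[OF td_G] G0])
  \<comment> \<open>Monotonicity of the integral needs both sides integrable; here smoothness of
    \<open>?L\<close> supplies continuity and \<open>h\<close> supplies the compact support.\<close>
  have int_L: "integrable lborel (inner2 nil3_metric ?L h)"
    by (rule integrable_zero_outside_compact[OF K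
          cont[OF times_differentiable_inner2_nil3[OF times_differentiable_linearized_flow_nil3[OF td] td]]])
      (simp add: h0 inner2_zero_right)
  have "(LINT x|lborel. inner2 nil3_metric ?L h x) \<le>
      (LINT x|lborel. pd 1 (F 1) x + pd 2 (F 2) x + pd 3 (F 3) x - G x - 1/2 * N x)"
    using int_F(1) int_N int_G int_L le by (intro integral_mono) auto
  also have "\<dots> = - (LINT x|lborel. G x) - 1/2 * (LINT x|lborel. N x)"
    using int_F int_N int_G by simp
  \<comment> \<open>Squaring undoes the square root in the norm because the integrand is
    nonnegative.\<close>
  also have "(LINT x|lborel. G x) = (L2_norm3 nil3_metric t)\<^sup>2"
    by (simp add: L2_norm3_def volume_measure_nil3 G_def inner3_nil3_nonneg)
  also have "(LINT x|lborel. N x) = (L2_norm2 nil3_metric h)\<^sup>2"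
    by (simp add: L2_norm2_def volume_measure_nil3 N_def inner2_nil3_nonneg)
  finally show ?thesis
    by (simp add: volume_measure_nil3 t_def)
qed

end
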